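(* Let $(R,\mathfrak m)$ be a Noetherian local domain and let $\{(\mathfrak a_\bullet(t),\mathfrak b_\bullet(t))\}_{t\in[0,1]}$ be a one-parameter family of pairs of filtrations of $\mathfrak m$-primary ideals in $R$. Let $\mathcal V=\{v_1,\dots,v_N\}$ be a fixed finite set of divisorial valuations centered at $\mathfrak m$, and put $\alpha_i(t):=v_i(\mathfrak a_\bullet(t))$, $\beta_i(t):=v_i(\mathfrak b_\bullet(t))$, and $L(t):=\mathcal L_{\mathfrak b_\bullet(t)}(\mathfrak a_\bullet(t))$. Assume that (1) for all $t\in[0,1]$ one has $L(t)=\max_{1\le i\le N}\frac{\alpha_i(t)}{\beta_i(t)}$; (2) the path $t\mapsto(\mathfrak a_\bullet(t),\mathfrak b_\bullet(t))$ is valuation-concave, and $\beta_i(t)>0$ for all $i$ and all $t\in[0,1]$. Then there exists a finite subset $\Sigma\subset[0,1]$ such that, on every connected component $I\subset[0,1]\setminus\Sigma$, one can choose an index $j=j(I)\in\{1,\dots,N\}$ with $$\frac1{L(t)}=\frac{\beta_j(t)}{\alpha_j(t)}\quad\text{for all }t\in I.$$ In particular, $t\mapsto1/L(t)$ is fractional linear (hence $C^\infty$) on each such $I$, and its second derivative has constant sign on $I$. Moreover, on a given component $I$ the restriction $t\mapsto1/L(t)$ is affine if and only if either $\alpha_j$ is constant on $I$ or the affine functions $\alpha_j$ and $\beta_j$ are proportional on $I$.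
   Context: A filtration is a family $\{\mathfrak a_p\}_{p\ge1}$ of proper ideals with $\mathfrak a_p\mathfrak a_{p'}\subseteq\mathfrak a_{p+p'}$ and $\mathfrak a_{p+1}\subseteq\mathfrak a_p$ for all $p,p'\ge1$. Algebraic Łojasiewicz exponent: $\mathcal L_{\mathfrak b_\bullet}(\mathfrak a_\bullet):=\inf\{\frac qp\in\mathbb Q_{>0}:\ \mathfrak b_{qt}\subseteq\overline{\mathfrak a_{pt}}\text{ for all integers }t\gg1\}\in\mathbb R_{\ge0}\cup\{\infty\}$, with $\inf\emptyset=\infty$, where $\overline I$ is the integral closure of $I$. For a valuation $v$ centered at $\mathfrak m$ (nonnegative on $R$, positive on $\mathfrak m$), $v(I):=\min\{v(x):x\in I\}$ and $v(\mathfrak a_\bullet):=\lim_{p\to\infty}\frac{v(\mathfrak a_p)}p=\inf_{p\ge1}\frac{v(\mathfrak a_p)}p$. Valuation-concave (also called valuation-affine): for every divisorial valuation $v$ centered at $\mathfrak m$, the functions $t\mapsto v(\mathfrak a_\bullet(t))$ and $t\mapsto v(\mathfrak b_\bullet(t))$ are affine on $[0,1]$. *)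

theory Defs
  imports "HOL-Analysis.Analysis" "HOL-Algebra.Algebra"
begin

section \<open>Noetherian local domains and filtrations\<close>

definition noetherian_local_domain :: "('a, 'm) ring_scheme \<Rightarrow> 'a set \<Rightarrow> bool" where
  "noetherian_local_domain R \<mm> \<longleftrightarrow>
     noetherian_domain R \<and> maximalideal \<mm> R \<and> (\<forall>M. maximalideal M R \<longrightarrow> M = \<mm>)"

definition radical_ideal :: "('a, 'm) ring_scheme \<Rightarrow> 'a set \<Rightarrow> 'a set" where
  "radical_ideal R I = {x \<in> carrier R. \<exists>n::nat. x [^]\<^bsub>R\<^esub> n \<in> I}"

definition primary_to :: "('a, 'm) ring_scheme \<Rightarrow> 'a set \<Rightarrow> 'a set \<Rightarrow> bool" where
  "primary_to R P I \<longleftrightarrow>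
     ideal I R \<and> I \<noteq> carrier R \<and>
     (\<forall>x\<in>carrier R. \<forall>y\<in>carrier R. x \<otimes>\<^bsub>R\<^esub> y \<in> I \<longrightarrow> x \<in> I \<or> y \<in> radical_ideal R I) \<and>
     radical_ideal R I = P"

text \<open>Filtrations are indexed by the positive integers; the member with index \<open>0\<close> is irrelevant
  here and in everything below.\<close>

definition filtration :: "('a, 'm) ring_scheme \<Rightarrow> (nat \<Rightarrow> 'a set) \<Rightarrow> bool" where
  "filtration R a \<longleftrightarrow>
     (\<forall>p\<ge>1. ideal (a p) R \<and> a p \<noteq> carrier R) \<and>
     (\<forall>p\<ge>1. \<forall>q\<ge>1. a p \<cdot>\<^bsub>R\<^esub> a q \<subseteq> a (p + q)) \<and>
     (\<forall>p\<ge>1. a (p + 1) \<subseteq> a p)"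

definition primary_filtration :: "('a, 'm) ring_scheme \<Rightarrow> 'a set \<Rightarrow> (nat \<Rightarrow> 'a set) \<Rightarrow> bool" where
  "primary_filtration R \<mm> a \<longleftrightarrow> filtration R a \<and> (\<forall>p\<ge>1. primary_to R \<mm> (a p))"

text \<open>Powers of an ideal are powers in the multiplicative monoid of all ideals.  The equation of
  integral dependence is \<open>x\<^sup>n + c\<^sub>1 x\<^bsup>n-1\<^esup> + \<dots> + c\<^sub>n = 0\<close> with \<open>c\<^sub>i \<in> I\<^sup>i\<close>.\<close>

definition integral_closure :: "('a, 'm) ring_scheme \<Rightarrow> 'a set \<Rightarrow> 'a set" where
  "integral_closure R I = {x \<in> carrier R. \<exists>n\<ge>1. \<exists>c.
     (\<forall>i\<in>{1..n}. c i \<in> I [^]\<^bsub>ideals_set R\<^esub> i) \<and>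
     x [^]\<^bsub>R\<^esub> n \<oplus>\<^bsub>R\<^esub> (\<Oplus>\<^bsub>R\<^esub>i\<in>{1..n}. c i \<otimes>\<^bsub>R\<^esub> x [^]\<^bsub>R\<^esub> (n - i :: nat)) = \<zero>\<^bsub>R\<^esub>}"

text \<open>The exponent of \<open>a\<close> with respect to \<open>b\<close>; as an infimum in \<^typ>\<open>ereal\<close> it is \<open>\<infinity>\<close> on the
  empty set.\<close>

definition lojasiewicz ::
  "('a, 'm) ring_scheme \<Rightarrow> (nat \<Rightarrow> 'a set) \<Rightarrow> (nat \<Rightarrow> 'a set) \<Rightarrow> ereal" where
  "lojasiewicz R b a = Inf {ereal (real q / real p) | p q. p \<ge> 1 \<and> q \<ge> 1 \<and>
     (\<forall>\<^sub>F t in sequentially. b (q * t) \<subseteq> integral_closure R (a (p * t)))}"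

section \<open>Divisorial valuations\<close>

text \<open>\<open>K\<close> is a field of fractions of \<open>R\<close> via the embedding \<open>\<iota>\<close>.\<close>

definition fraction_field ::
  "('a, 'm) ring_scheme \<Rightarrow> ('k, 'n) ring_scheme \<Rightarrow> ('a \<Rightarrow> 'k) \<Rightarrow> bool" where
  "fraction_field R K \<iota> \<longleftrightarrow>
     field K \<and> \<iota> \<in> ring_hom R K \<and> inj_on \<iota> (carrier R) \<and>
     (\<forall>z\<in>carrier K. \<exists>x\<in>carrier R. \<exists>y\<in>carrier R - {\<zero>\<^bsub>R\<^esub>}. z = \<iota> x \<otimes>\<^bsub>K\<^esub> inv\<^bsub>K\<^esub> (\<iota> y))"

text \<open>Normalised discrete valuations (value group \<open>\<int>\<close>).  The convention \<open>v 0 = \<infinity>\<close> is rendered by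
  never evaluating \<open>v\<close> at \<open>0\<close>.\<close>

definition discrete_valuation :: "('k, 'n) ring_scheme \<Rightarrow> ('k \<Rightarrow> int) \<Rightarrow> bool" where
  "discrete_valuation K v \<longleftrightarrow>
     (\<forall>x\<in>carrier K - {\<zero>\<^bsub>K\<^esub>}. \<forall>y\<in>carrier K - {\<zero>\<^bsub>K\<^esub>}.
        v (x \<otimes>\<^bsub>K\<^esub> y) = v x + v y \<and>
        (x \<oplus>\<^bsub>K\<^esub> y \<noteq> \<zero>\<^bsub>K\<^esub> \<longrightarrow> min (v x) (v y) \<le> v (x \<oplus>\<^bsub>K\<^esub> y))) \<and>
     v ` (carrier K - {\<zero>\<^bsub>K\<^esub>}) = UNIV"

definition valuation_ring :: "('k, 'n) ring_scheme \<Rightarrow> ('k \<Rightarrow> int) \<Rightarrow> ('k, 'n) ring_scheme" where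
  "valuation_ring K v = K\<lparr>carrier := {x \<in> carrier K. x \<noteq> \<zero>\<^bsub>K\<^esub> \<longrightarrow> 0 \<le> v x}\<rparr>"

definition valuation_ideal :: "('k, 'n) ring_scheme \<Rightarrow> ('k \<Rightarrow> int) \<Rightarrow> 'k set" where
  "valuation_ideal K v = {x \<in> carrier K. x \<noteq> \<zero>\<^bsub>K\<^esub> \<longrightarrow> 0 < v x}"

definition valuation_residue_field :: "('k, 'n) ring_scheme \<Rightarrow> ('k \<Rightarrow> int) \<Rightarrow> 'k set ring" where
  "valuation_residue_field K v = valuation_ring K v Quot valuation_ideal K v"

text \<open>The image of \<open>R\<close> in the residue field of \<open>v\<close>.  If \<open>v\<close> is centered at \<open>\<mm>\<close>, this is the
  residue field \<open>R/\<mm>\<close>, embedded as a subfield.\<close>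

definition center_residue_field ::
  "('a, 'm) ring_scheme \<Rightarrow> ('k, 'n) ring_scheme \<Rightarrow> ('a \<Rightarrow> 'k) \<Rightarrow> ('k \<Rightarrow> int) \<Rightarrow> 'k set set" where
  "center_residue_field R K \<iota> v =
     (\<lambda>x. valuation_ideal K v +>\<^bsub>valuation_ring K v\<^esub> \<iota> x) ` carrier R"

text \<open>\<open>S\<close> is a transcendence basis of the field \<open>F\<close> over its subfield \<open>k\<close>: no element of \<open>S\<close> is
  algebraic over the field generated by the others, and \<open>F\<close> is algebraic over \<open>k(S)\<close>.\<close>

definition transcendence_basis :: "('a, 'm) ring_scheme \<Rightarrow> 'a set \<Rightarrow> 'a set \<Rightarrow> bool" where
  "transcendence_basis F k S \<longleftrightarrow>
     S \<subseteq> carrier F \<and>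
     (\<forall>s\<in>S. (ring.transcendental F over generate_field F (k \<union> (S - {s}))) s) \<and>
     (\<forall>x\<in>carrier F. (ring.algebraic F over generate_field F (k \<union> S)) x)"

definition krull_dim :: "('a, 'm) ring_scheme \<Rightarrow> enat" where
  "krull_dim R = Sup {enat n | n. \<exists>P. (\<forall>i\<le>n. primeideal (P i) R) \<and> (\<forall>i<n. P i \<subset> P (Suc i))}"

definition valuation_centered_at ::
  "('a, 'm) ring_scheme \<Rightarrow> 'a set \<Rightarrow> ('a \<Rightarrow> 'k) \<Rightarrow> ('k \<Rightarrow> int) \<Rightarrow> bool" where
  "valuation_centered_at R \<mm> \<iota> v \<longleftrightarrow>
     (\<forall>x\<in>carrier R - {\<zero>\<^bsub>R\<^esub>}. 0 \<le> v (\<iota> x)) \<and> (\<forall>x\<in>\<mm> - {\<zero>\<^bsub>R\<^esub>}. 0 < v (\<iota> x))"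

text \<open>Divisorial valuations centered at \<open>\<mm>\<close>: the transcendence degree of the residue field of \<open>v\<close>
  over \<open>R/\<mm>\<close> is \<open>dim R - 1\<close>.\<close>

definition divisorial_valuation ::
  "('a, 'm) ring_scheme \<Rightarrow> 'a set \<Rightarrow> ('k, 'n) ring_scheme \<Rightarrow> ('a \<Rightarrow> 'k) \<Rightarrow> ('k \<Rightarrow> int) \<Rightarrow> bool" where
  "divisorial_valuation R \<mm> K \<iota> v \<longleftrightarrow>
     discrete_valuation K v \<and> valuation_centered_at R \<mm> \<iota> v \<and>
     (\<exists>S. finite S \<and>
        transcendence_basis (valuation_residue_field K v) (center_residue_field R K \<iota> v) S \<and>
        enat (card S) + 1 = krull_dim R)"

definition ideal_value ::
  "('a, 'm) ring_scheme \<Rightarrow> ('a \<Rightarrow> 'k) \<Rightarrow> ('k \<Rightarrow> int) \<Rightarrow> 'a set \<Rightarrow> int" where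
  "ideal_value R \<iota> v I = (LEAST n. \<exists>x\<in>I - {\<zero>\<^bsub>R\<^esub>}. n = v (\<iota> x))"

definition filtration_value ::
  "('a, 'm) ring_scheme \<Rightarrow> ('a \<Rightarrow> 'k) \<Rightarrow> ('k \<Rightarrow> int) \<Rightarrow> (nat \<Rightarrow> 'a set) \<Rightarrow> real" where
  "filtration_value R \<iota> v a = lim (\<lambda>p. real_of_int (ideal_value R \<iota> v (a p)) / real p)"

section \<open>Functions of one real variable\<close>

definition affine_fun_on :: "real set \<Rightarrow> (real \<Rightarrow> real) \<Rightarrow> bool" where
  "affine_fun_on S f \<longleftrightarrow> (\<exists>c d. \<forall>t\<in>S. f t = c * t + d)"

definition fractional_linear_on :: "real set \<Rightarrow> (real \<Rightarrow> real) \<Rightarrow> bool" where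
  "fractional_linear_on S f \<longleftrightarrow>
     (\<exists>a b c d. \<forall>t\<in>S. c * t + d \<noteq> 0 \<and> f t = (a * t + b) / (c * t + d))"

definition proportional_on :: "real set \<Rightarrow> (real \<Rightarrow> real) \<Rightarrow> (real \<Rightarrow> real) \<Rightarrow> bool" where
  "proportional_on S f g \<longleftrightarrow> (\<exists>c d. (c \<noteq> 0 \<or> d \<noteq> 0) \<and> (\<forall>t\<in>S. c * f t = d * g t))"

text \<open>Derivatives are taken within \<open>S\<close>, so they are one-sided at an endpoint of an interval.\<close>

primrec higher_deriv_within :: "real set \<Rightarrow> nat \<Rightarrow> (real \<Rightarrow> real) \<Rightarrow> real \<Rightarrow> real" where
  "higher_deriv_within S 0 f = f"
| "higher_deriv_within S (Suc n) f =
     (\<lambda>t. vector_derivative (higher_deriv_within S n f) (at t within S))"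

definition smooth_fun_on :: "real set \<Rightarrow> (real \<Rightarrow> real) \<Rightarrow> bool" where
  "smooth_fun_on S f \<longleftrightarrow> (\<forall>n. higher_deriv_within S n f differentiable_on S)"

definition valuation_concave ::
  "('a, 'm) ring_scheme \<Rightarrow> 'a set \<Rightarrow> ('k, 'n) ring_scheme \<Rightarrow> ('a \<Rightarrow> 'k) \<Rightarrow>
   (real \<Rightarrow> nat \<Rightarrow> 'a set) \<Rightarrow> (real \<Rightarrow> nat \<Rightarrow> 'a set) \<Rightarrow> bool" where
  "valuation_concave R \<mm> K \<iota> a b \<longleftrightarrow>
     (\<forall>v. divisorial_valuation R \<mm> K \<iota> v \<longrightarrow>
        affine_fun_on {0..1} (\<lambda>t. filtration_value R \<iota> v (a t)) \<and>
        affine_fun_on {0..1} (\<lambda>t. filtration_value R \<iota> v (b t)))"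

end

theory Submission
  imports Defs
begin

text \<open>By (1) and (2), \<open>L\<close> is the maximum of finitely many quotients \<open>\<alpha>\<^sub>i / \<beta>\<^sub>i\<close> of affine functions.
  Two of them are compared by the sign of the quadratic polynomial \<open>\<alpha>\<^sub>i \<beta>\<^sub>k - \<alpha>\<^sub>k \<beta>\<^sub>i\<close>.  Let
  \<open>\<Sigma>\<close> collect the zeros in \<open>[0,1]\<close> of those polynomials \<open>\<alpha>\<^sub>i \<beta>\<^sub>k - \<alpha>\<^sub>k \<beta>\<^sub>i\<close> and \<open>\<alpha>\<^sub>i\<close> that do not
  vanish identically.  All these signs are constant on a component of the complement, so an
  index that is maximal at one point is maximal on the whole component.\<close>

section \<open>Sign of the exponent and topology of the components\<close>

lemma lojasiewicz_nonneg: "0 \<le> lojasiewicz R b a"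
  unfolding lojasiewicz_def by (rule Inf_greatest) auto

text \<open>A small ball about \<open>x\<close> misses the closed set \<open>\<Sigma>\<close>, and
  its trace on the interval is convex, so it stays inside the component. Hence no component is a
  single point; this makes derivatives within \<open>I\<close> unique and \<open>I\<close>
  infinite.\<close>

lemma component_diff_finite_islimpt:
  fixes \<Sigma> :: "real set"
  assumes "finite \<Sigma>" "a < b" "I \<in> components ({a..b} - \<Sigma>)" "x \<in> I"
  shows "x islimpt I"
proof -
  have x: "x \<in> {a..b}" "x \<in> - \<Sigma>"
    using in_components_subset[OF assms(3)] assms(4) by auto
  have "open (- \<Sigma>)"
    using assms(1) by (simp add: finite_imp_closed open_Compl)
  then obtain e where e: "e > 0" "ball x e \<subseteq> - \<Sigma>"
    using x(2) open_contains_ball by blast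
  have "connected ({a..b} \<inter> ball x e)"
    by (intro convex_connected convex_Int) auto
  then have sub: "{a..b} \<inter> ball x e \<subseteq> I"
    using e x assms(4) by (intro components_maximal[OF assms(3)]) auto
  have "x islimpt {a..b}"
    using x(1) assms(2) by simp
  then have "x islimpt {a..b} \<inter> ball x e"
    using islimpt_Int_eventually eventually_at_ball[OF e(1), of x UNIV] by (simp del: mem_ball)
  then show ?thesis
    using sub islimpt_subset by blast
qed

lemma connected_no_zero_pos:
  fixes f :: "real \<Rightarrow> real"
  assumes "connected I" "continuous_on I f" "\<And>x. x \<in> I \<Longrightarrow> f x \<noteq> 0"
    and "s \<in> I" "f s > 0" "t \<in> I"
  shows "f t > 0"
proof (rule ccontr)
  assume "\<not> f t > 0"
  moreover have "connected (f ` I)"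
    using assms(1,2) connected_continuous_image by blast
  ultimately have "0 \<in> f ` I"
    using assms(4-6) connectedD_interval[of "f ` I" "f t" "f s" 0] by force
  then show False
    using assms(3) by auto
qed

section \<open>Derivatives of fractional linear functions\<close>

lemma DERIV_const_divide_affine_power:
  fixes c d K t :: real
  assumes "c * t + d \<noteq> 0"
  shows "((\<lambda>t. K / (c * t + d) ^ Suc m) has_real_derivative
           - (K * real (Suc m) * c) / (c * t + d) ^ Suc (Suc m)) (at t within I)"
proof -
  define u where "u = c * t + d"
  have "((\<lambda>t. c * t + d) has_real_derivative c) (at t within I)"
    by (auto intro!: derivative_eq_intros)
  from DERIV_power[OF this, of "Suc m"]
  have "((\<lambda>t. (c * t + d) ^ Suc m) has_real_derivative real (Suc m) * (u ^ m * c)) (at t within I)"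
    by (simp add: u_def mult.commute del: power_Suc of_nat_Suc)
  then have "((\<lambda>t. K / (c * t + d) ^ Suc m) has_real_derivative
          (0 * u ^ Suc m - K * (real (Suc m) * (u ^ m * c))) / (u ^ Suc m * u ^ Suc m)) (at t within I)"
    unfolding u_def using assms
    by (intro DERIV_divide DERIV_const) auto
  also have "(0 * u ^ Suc m - K * (real (Suc m) * (u ^ m * c))) / (u ^ Suc m * u ^ Suc m) =
               - (K * real (Suc m) * c) / u ^ Suc (Suc m)"
    using assms by (simp add: u_def[symmetric] field_simps del: of_nat_Suc)
  finally show ?thesis
    unfolding u_def .
qed

text \<open>The first derivative is \<open>(a * d - b * c) / (c * t + d) ^ 2\<close>; by the
  preceding rule every further one brings in a factor \<open>- c\<close> and the next integer.
  Differentiability is recorded next to the closed form because smoothness asks for it at every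
  order.\<close>

lemma higher_deriv_within_fractional_linear:
  assumes lim: "\<And>x. x \<in> I \<Longrightarrow> x islimpt I"
    and nz: "\<And>x. x \<in> I \<Longrightarrow> c * x + d \<noteq> 0"
    and f: "\<And>x. x \<in> I \<Longrightarrow> f x = (a * x + b) / (c * x + d)"
    and t: "t \<in> I"
  shows "higher_deriv_within I (Suc n) f t =
           (a * d - b * c) * (- c) ^ n * fact (Suc n) / (c * t + d) ^ (n + 2)"
    and "(higher_deriv_within I n f has_real_derivative
           higher_deriv_within I (Suc n) f t) (at t within I)"
proof -
  let ?g = "\<lambda>n t. (a * d - b * c) * (- c) ^ n * fact (Suc n) / (c * t + d) ^ (n + 2)"
  \<comment> \<open>\<open>vector_derivative\<close> is a choice operator; at a limit point of
    \<open>I\<close> derivatives within \<open>I\<close> are unique, so it returns any derivative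
    that has been exhibited.\<close>
  have vd: "higher_deriv_within I (Suc n) f t = D"
    if "(higher_deriv_within I n f has_real_derivative D) (at t within I)" "t \<in> I" for n D t
    using that lim[OF that(2)] by (auto simp: has_real_derivative_iff_has_vector_derivative
        trivial_limit_within intro!: vector_derivative_within)
  have step: "(higher_deriv_within I n f has_real_derivative ?g n t) (at t within I)"
    if t: "t \<in> I" for n t
    using t
  proof (induction n arbitrary: t)
    case 0
    have "((\<lambda>x. (a * x + b) / (c * x + d)) has_real_derivative ?g 0 t) (at t within I)"
      using nz[OF 0]
      by (auto intro!: derivative_eq_intros simp: power2_eq_square field_simps)
    then show ?case
      by (rule has_field_derivative_transform_within[OF _ zero_less_one 0]) (use f in auto)
  next
    case (Suc n)
    \<comment> \<open>The exponent \<open>n + 2\<close> is \<open>Suc m\<close> for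
      \<open>m = n + 1\<close>. The induction hypothesis, read through \<open>vd\<close>, identifies
      the derivative of order \<open>Suc n\<close> with \<open>?g n\<close> on all of
      \<open>I\<close>.\<close>
    have "(?g n has_real_derivative ?g (Suc n) t) (at t within I)"
      using DERIV_const_divide_affine_power[OF nz[OF Suc.prems],
          of "(a * d - b * c) * (- c) ^ n * fact (Suc n)" "n + 1" I]
      by (simp add: algebra_simps del: power_Suc) (simp add: algebra_simps)
    then show ?case
      by (rule has_field_derivative_transform_within[OF _ zero_less_one Suc.prems])
        (use vd[OF Suc.IH] in auto)
  qed
  show "higher_deriv_within I (Suc n) f t = ?g n t"
    using vd[OF step] t by blast
  then show "(higher_deriv_within I n f has_real_derivative
           higher_deriv_within I (Suc n) f t) (at t within I)"
    using step[OF t, of n] by simp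
qed

lemma smooth_fun_on_fractional_linear:
  assumes "\<And>x. x \<in> I \<Longrightarrow> x islimpt I" "\<And>x. x \<in> I \<Longrightarrow> c * x + d \<noteq> 0"
    and "\<And>x. x \<in> I \<Longrightarrow> f x = (a * x + b) / (c * x + d)"
  shows "smooth_fun_on I f"
  unfolding smooth_fun_on_def differentiable_on_def
  using higher_deriv_within_fractional_linear(2)[OF assms] real_differentiable_def by blast

text \<open>The second derivative is \<open>- 2 * c * (a * d - b * c) / (c * t + d) ^ 3\<close>.
  With a positive denominator its sign is that of the constant numerator.\<close>

lemma sgn_second_deriv_fractional_linear_constant:
  assumes "\<And>x. x \<in> I \<Longrightarrow> x islimpt I" "\<And>x. x \<in> I \<Longrightarrow> c * x + d > 0"
    and "\<And>x. x \<in> I \<Longrightarrow> f x = (a * x + b) / (c * x + d)"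
  shows "(\<lambda>t. sgn (higher_deriv_within I 2 f t)) constant_on I"
proof -
  have "sgn (higher_deriv_within I 2 f t) = sgn ((a * d - b * c) * (- c))" if "t \<in> I" for t
  proof -
    have nz: "c * x + d \<noteq> 0" if "x \<in> I" for x
      using assms(2)[OF that] by simp
    have "higher_deriv_within I 2 f t = (a * d - b * c) * (- c) * 2 / (c * t + d) ^ 3"
      using higher_deriv_within_fractional_linear(1)[OF assms(1) nz assms(3) that, of 1]
      by (simp del: higher_deriv_within.simps add: numeral_2_eq_2 numeral_3_eq_3)
    then show ?thesis
      using assms(2)[OF that] by (simp add: sgn_mult)
  qed
  then show ?thesis
    unfolding constant_on_def by blast
qed

section \<open>When a quotient of affine functions is affine\<close>

lemma affine_ratio_affine_iff:
  fixes f g h :: "real \<Rightarrow> real"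
  assumes "infinite I" and "\<And>x. x \<in> I \<Longrightarrow> f x \<noteq> 0"
    and "affine_fun_on I f" "affine_fun_on I g" and h: "\<And>x. x \<in> I \<Longrightarrow> h x = g x / f x"
  shows "affine_fun_on I h \<longleftrightarrow> f constant_on I \<or> proportional_on I f g"
proof -
  obtain c d where f: "\<And>x. x \<in> I \<Longrightarrow> f x = c * x + d"
    using assms(3) unfolding affine_fun_on_def by blast
  obtain a b where g: "\<And>x. x \<in> I \<Longrightarrow> g x = a * x + b"
    using assms(4) unfolding affine_fun_on_def by blast
  show ?thesis
  proof
    assume "affine_fun_on I h"
    then obtain p q where hpq: "\<And>x. x \<in> I \<Longrightarrow> h x = p * x + q"
      unfolding affine_fun_on_def by blast
    \<comment> \<open>Affinity of \<open>h\<close> turns \<open>f x * h x = g x\<close> into an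
      equation between polynomials; having infinitely many solutions, it is an identity.\<close>
    have "I \<subseteq> {x. poly ([:d, c:] * [:q, p:] - [:b, a:]) x = 0}"
      using hpq h assms(2) f g by (force simp: field_simps)
    then have eq: "[:d, c:] * [:q, p:] - [:b, a:] = 0"
      using poly_roots_finite assms(1) finite_subset by blast
    \<comment> \<open>The coefficient of degree two in the identity is \<open>c * p\<close>.\<close>
    then consider "c = 0" | "p = 0"
      by auto
    then show "f constant_on I \<or> proportional_on I f g"
    proof cases
      case 1
      then show ?thesis
        using f unfolding constant_on_def by auto
    next
      case 2
      have "q * f x = 1 * g x" if "x \<in> I" for x
        using hpq[OF that] h[OF that] 2 assms(2)[OF that] by (simp add: field_simps)
      then show ?thesis
        unfolding proportional_on_def by (metis zero_neq_one)
    qed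
  next
    assume "f constant_on I \<or> proportional_on I f g"
    then show "affine_fun_on I h"
    proof
      assume "f constant_on I"
      then obtain y where "\<And>x. x \<in> I \<Longrightarrow> f x = y"
        unfolding constant_on_def by blast
      then have "h x = (a / y) * x + b / y" if "x \<in> I" for x
        using h g that by (simp add: add_divide_distrib)
      then show ?thesis
        unfolding affine_fun_on_def by blast
    next
      assume "proportional_on I f g"
      then obtain p q where pq: "p \<noteq> 0 \<or> q \<noteq> 0" "\<And>x. x \<in> I \<Longrightarrow> p * f x = q * g x"
        unfolding proportional_on_def by blast
      \<comment> \<open>If \<open>q = 0\<close>, then \<open>p * f x = 0\<close> at some point of
        \<open>I\<close> with \<open>f x \<noteq> 0\<close>, so \<open>p = 0\<close> as well,
        against \<open>pq\<close>.\<close>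
      have "q \<noteq> 0"
        using pq assms(1,2) by (metis finite.emptyI equals0I mult_eq_0_iff)
      have "h x = 0 * x + p / q" if x: "x \<in> I" for x
      proof -
        have "(q * h x) * f x = p * f x"
          using h pq(2) assms(2) x by simp
        then show ?thesis
          using assms(2)[OF x] \<open>q \<noteq> 0\<close> by (simp add: eq_divide_eq mult.commute)
      qed
      then show ?thesis
        unfolding affine_fun_on_def by blast
    qed
  qed
qed

section \<open>Maximum of finitely many ratios of affine functions\<close>

lemma Max_affine_ratios_piecewise:
  fixes \<alpha> \<beta> :: "'i \<Rightarrow> real \<Rightarrow> real"
  assumes "finite J" "J \<noteq> {}"
    and "\<And>i. i \<in> J \<Longrightarrow> affine_fun_on {0..1} (\<alpha> i)" "\<And>i. i \<in> J \<Longrightarrow> affine_fun_on {0..1} (\<beta> i)"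
    and pos: "\<And>i t. i \<in> J \<Longrightarrow> t \<in> {0..1} \<Longrightarrow> \<beta> i t > 0"
  obtains \<Sigma> where "finite \<Sigma>" "\<Sigma> \<subseteq> {0..1}"
    "\<And>I. I \<in> components ({0..1} - \<Sigma>) \<Longrightarrow>
       \<exists>j\<in>J. (\<forall>t\<in>I. (MAX i\<in>J. \<alpha> i t / \<beta> i t) = \<alpha> j t / \<beta> j t) \<and>
             ((\<forall>t\<in>I. \<alpha> j t = 0) \<or> (\<forall>t\<in>I. \<alpha> j t \<noteq> 0))"
proof -
  \<comment> \<open>Polynomials make "does not vanish identically" an algebraic condition and have
    finitely many roots when it holds.\<close>
  have "\<exists>p. \<forall>t\<in>{0..1}. f t = poly p t" if "affine_fun_on {0..1} f" for f
  proof -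
    obtain c d where "\<forall>t\<in>{0..1}. f t = c * t + d"
      using \<open>affine_fun_on {0..1} f\<close> unfolding affine_fun_on_def by blast
    then have "\<forall>t\<in>{0..1}. f t = poly [:d, c:] t"
      by (simp add: algebra_simps)
    then show ?thesis
      by blast
  qed
  then have "\<exists>P. \<forall>i\<in>J. \<forall>t\<in>{0..1}. f i t = poly (P i) t"
    if "\<And>i. i \<in> J \<Longrightarrow> affine_fun_on {0..1} (f i)" for f :: "'i \<Rightarrow> real \<Rightarrow> real"
    using that by (intro bchoice) blast
  from this[of \<alpha>] this[of \<beta>] obtain A B
    where A: "\<And>i t. i \<in> J \<Longrightarrow> t \<in> {0..1} \<Longrightarrow> \<alpha> i t = poly (A i) t"
      and B: "\<And>i t. i \<in> J \<Longrightarrow> t \<in> {0..1} \<Longrightarrow> \<beta> i t = poly (B i) t"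
    using assms(3,4) by blast
  define Q where "Q = (\<lambda>(i, k). A i * B k - A k * B i)"
  define P where "P = A ` J \<union> Q ` (J \<times> J) - {0}"
  define \<Sigma> where "\<Sigma> = {0..1} \<inter> (\<Union>p\<in>P. {t. poly p t = 0})"
  have "finite P"
    unfolding P_def using \<open>finite J\<close> by simp
  then have "finite (\<Union>p\<in>P. {t. poly p t = 0})"
    by (rule finite_UN_I) (auto simp: P_def intro: poly_roots_finite)
  then have "finite \<Sigma>"
    unfolding \<Sigma>_def by simp
  moreover have "\<Sigma> \<subseteq> {0..1}"
    unfolding \<Sigma>_def by blast
  moreover have "\<exists>j\<in>J. (\<forall>t\<in>I. (MAX i\<in>J. \<alpha> i t / \<beta> i t) = \<alpha> j t / \<beta> j t) \<and>
             ((\<forall>t\<in>I. \<alpha> j t = 0) \<or> (\<forall>t\<in>I. \<alpha> j t \<noteq> 0))"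
    if I: "I \<in> components ({0..1} - \<Sigma>)" for I
  proof -
    have I01: "I \<subseteq> {0..1}" and IS: "I \<inter> \<Sigma> = {}"
      using in_components_subset[OF I] by auto
    obtain s where s: "s \<in> I"
      using in_components_nonempty[OF I] by blast
    \<comment> \<open>A root on \<open>I\<close> lies in \<open>[0,1]\<close> but outside
      \<open>\<Sigma>\<close>, so its polynomial is not in \<open>P\<close>, that is, it is
      zero.\<close>
    have nz: "p = 0 \<or> (\<forall>t\<in>I. poly p t \<noteq> 0)" if "p \<in> A ` J \<union> Q ` (J \<times> J)" for p
    proof (rule disjCI)
      assume "\<not> (\<forall>t\<in>I. poly p t \<noteq> 0)"
      then show "p = 0"
        using that I01 IS unfolding \<Sigma>_def P_def by fast
    qed
    let ?m = "\<lambda>t. MAX i\<in>J. \<alpha> i t / \<beta> i t"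
    have "?m s \<in> (\<lambda>i. \<alpha> i s / \<beta> i s) ` J"
      using assms(1,2) by (intro Max_in) auto
    then obtain j where j: "j \<in> J" "?m s = \<alpha> j s / \<beta> j s"
      by auto
    have iff: "\<alpha> k t / \<beta> k t \<le> \<alpha> j t / \<beta> j t \<longleftrightarrow> poly (Q (j, k)) t \<ge> 0" if "k \<in> J" "t \<in> I" for k t
      using A B pos that j(1) I01 by (auto simp: Q_def field_simps subset_iff)
    have "?m t = \<alpha> j t / \<beta> j t" if t: "t \<in> I" for t
    proof (rule Max_eqI)
      fix y assume "y \<in> (\<lambda>i. \<alpha> i t / \<beta> i t) ` J"
      then obtain k where k: "k \<in> J" "y = \<alpha> k t / \<beta> k t"
        by blast
      have "\<alpha> k s / \<beta> k s \<le> \<alpha> j s / \<beta> j s"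
        unfolding j(2)[symmetric] using \<open>finite J\<close> k(1) by (intro Max_ge) auto
      then have ge: "poly (Q (j, k)) s \<ge> 0"
        using iff k(1) s by blast
      have "poly (Q (j, k)) t \<ge> 0"
      \<comment> \<open>Either the ratios for \<open>j\<close> and \<open>k\<close> coincide on
        \<open>I\<close>, or \<open>Q (j, k)\<close> has no zero there and, by the intermediate
        value theorem, keeps the positive sign it has at \<open>s\<close>.\<close>
      proof (cases "Q (j, k) = 0")
        case False
        then have n: "\<forall>x\<in>I. poly (Q (j, k)) x \<noteq> 0"
          using nz[of "Q (j, k)"] j(1) k(1) by blast
        have "continuous_on I (poly (Q (j, k)))"
          by (intro continuous_intros)
        moreover have "poly (Q (j, k)) s > 0"
          using n ge s by (auto simp: less_le)
        ultimately have "poly (Q (j, k)) t > 0"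
          using connected_no_zero_pos[OF in_components_connected[OF I]] n s t by blast
        then show ?thesis
          by simp
      qed simp
      then show "y \<le> \<alpha> j t / \<beta> j t"
        using iff k t by blast
    qed (use assms(1) j(1) in auto)
    \<comment> \<open>The polynomials \<open>A i\<close> belong to the family for the sake of this
      dichotomy: it will separate components with \<open>L = 0\<close>, where \<open>1 / L\<close>
      is infinite, from those with \<open>L > 0\<close>.\<close>
    moreover have "(\<forall>t\<in>I. \<alpha> j t = 0) \<or> (\<forall>t\<in>I. \<alpha> j t \<noteq> 0)"
      using nz[of "A j"] j(1) A I01 by fastforce
    ultimately show ?thesis
      using j(1) by blast
  qed
  ultimately show ?thesis
    by (rule that)
qed

text \<open>Quotients are formed in \<open>ereal\<close>: where \<open>L\<close> vanishes,
  \<open>1 / L\<close> is \<open>\<infinity>\<close>, which \<open>real_of_ereal\<close> sends to 0,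
  so on such a component the regularity claims concern the zero function. The criterion for affinity
  covers every index representing \<open>1 / L\<close> on \<open>I\<close>, not just a chosen
  one.\<close>

theorem theorem9p14:
  fixes R :: "('a, 'm) ring_scheme" and \<mm> :: "'a set"
    and K :: "('k, 'n) ring_scheme" and \<iota> :: "'a \<Rightarrow> 'k"
    and a b :: "real \<Rightarrow> nat \<Rightarrow> 'a set"
    and N :: nat and v :: "nat \<Rightarrow> 'k \<Rightarrow> int"
    and \<alpha> \<beta> :: "nat \<Rightarrow> real \<Rightarrow> real" and L :: "real \<Rightarrow> ereal"
  assumes "noetherian_local_domain R \<mm>"
    and "fraction_field R K \<iota>"
    and "\<And>t. t \<in> {0..1} \<Longrightarrow> primary_filtration R \<mm> (a t) \<and> primary_filtration R \<mm> (b t)"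
    and "N \<ge> 1"
    and "\<And>i. i \<in> {1..N} \<Longrightarrow> divisorial_valuation R \<mm> K \<iota> (v i)"
    and "\<And>i t. \<alpha> i t = filtration_value R \<iota> (v i) (a t)"
    and "\<And>i t. \<beta> i t = filtration_value R \<iota> (v i) (b t)"
    and "\<And>t. L t = lojasiewicz R (b t) (a t)"
    and "\<And>t. t \<in> {0..1} \<Longrightarrow> L t = ereal (MAX i\<in>{1..N}. \<alpha> i t / \<beta> i t)"
    and "valuation_concave R \<mm> K \<iota> a b"
    and "\<And>i t. i \<in> {1..N} \<Longrightarrow> t \<in> {0..1} \<Longrightarrow> \<beta> i t > 0"
  shows "\<exists>\<Sigma>. finite \<Sigma> \<and> \<Sigma> \<subseteq> {0..1} \<and>
    (\<forall>I\<in>components ({0..1} - \<Sigma>).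
       (\<exists>j\<in>{1..N}. \<forall>t\<in>I. 1 / L t = ereal (\<beta> j t) / ereal (\<alpha> j t)) \<and>
       ((\<forall>t\<in>I. L t = 0) \<or> (\<forall>t\<in>I. L t > 0)) \<and>
       fractional_linear_on I (\<lambda>t. real_of_ereal (1 / L t)) \<and>
       smooth_fun_on I (\<lambda>t. real_of_ereal (1 / L t)) \<and>
       (\<lambda>t. sgn (higher_deriv_within I 2 (\<lambda>t. real_of_ereal (1 / L t)) t)) constant_on I \<and>
       (\<forall>j\<in>{1..N}. (\<forall>t\<in>I. 1 / L t = ereal (\<beta> j t) / ereal (\<alpha> j t)) \<longrightarrow>
          (affine_fun_on I (\<lambda>t. real_of_ereal (1 / L t)) \<longleftrightarrow>
             \<alpha> j constant_on I \<or> proportional_on I (\<alpha> j) (\<beta> j))))"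
proof -
  have aff: "affine_fun_on {0..1} (\<alpha> i)" "affine_fun_on {0..1} (\<beta> i)" if "i \<in> {1..N}" for i
    using assms(5)[OF that] assms(10) unfolding valuation_concave_def assms(6,7) by blast+
  have "{1..N} \<noteq> {}"
    using assms(4) by simp
  then obtain \<Sigma> where \<Sigma>: "finite \<Sigma>" "\<Sigma> \<subseteq> {0..1}"
    and max: "\<And>I. I \<in> components ({0..1} - \<Sigma>) \<Longrightarrow>
       \<exists>j\<in>{1..N}. (\<forall>t\<in>I. (MAX i\<in>{1..N}. \<alpha> i t / \<beta> i t) = \<alpha> j t / \<beta> j t) \<and>
             ((\<forall>t\<in>I. \<alpha> j t = 0) \<or> (\<forall>t\<in>I. \<alpha> j t \<noteq> 0))"
    using Max_affine_ratios_piecewise[of "{1..N}" \<alpha> \<beta>] aff assms(11) by blast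
  show ?thesis
  proof (intro exI[of _ \<Sigma>] conjI ballI \<Sigma>)
    fix I assume I: "I \<in> components ({0..1} - \<Sigma>)"
    let ?f = "\<lambda>t. real_of_ereal (1 / L t)"
    have I01: "I \<subseteq> {0..1}"
      using in_components_subset[OF I] by auto
    have lim: "x islimpt I" if "x \<in> I" for x
      using component_diff_finite_islimpt[OF \<Sigma>(1) _ I that] by simp
    have inf: "infinite I"
      using lim in_components_nonempty[OF I] islimpt_finite by blast
    obtain j where j: "j \<in> {1..N}" "\<And>t. t \<in> I \<Longrightarrow> L t = ereal (\<alpha> j t / \<beta> j t)"
      and dich: "(\<forall>t\<in>I. \<alpha> j t = 0) \<or> (\<forall>t\<in>I. \<alpha> j t \<noteq> 0)"
      using max[OF I] assms(9) I01 by (metis subsetD)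
    have \<beta>: "\<beta> i t > 0" if "i \<in> {1..N}" "t \<in> I" for i t
      using assms(11) that I01 by blast
    have Lnn: "L t \<ge> 0" for t
      unfolding assms(8) by (rule lojasiewicz_nonneg)
    \<comment> \<open>The sign comes from \<open>L t \<ge> 0\<close> and
      \<open>\<beta> j t > 0\<close>, rather than from the limit defining
      \<open>filtration_value\<close>.\<close>
    have \<alpha>nn: "\<alpha> j t \<ge> 0" if "t \<in> I" for t
      using Lnn[of t] j(2)[OF that] \<beta>[OF j(1) that] by (simp add: zero_le_divide_iff)
    \<comment> \<open>If \<open>\<alpha> j t = 0\<close>, both sides are \<open>\<infinity>\<close>
      because \<open>\<beta> j t > 0\<close>.\<close>
    have eqj: "1 / L t = ereal (\<beta> j t) / ereal (\<alpha> j t)" if "t \<in> I" for t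
      using j(2)[OF that] \<beta>[OF j(1) that] \<alpha>nn[OF that]
      by (cases "\<alpha> j t = 0") (auto simp: divide_ereal_def divide_inverse)
    show "\<exists>j\<in>{1..N}. \<forall>t\<in>I. 1 / L t = ereal (\<beta> j t) / ereal (\<alpha> j t)"
      using eqj j(1) by blast
    show sgnL: "(\<forall>t\<in>I. L t = 0) \<or> (\<forall>t\<in>I. L t > 0)"
      using dich
    proof
      assume "\<forall>t\<in>I. \<alpha> j t = 0"
      then show ?thesis
        using j(2) by simp
    next
      assume "\<forall>t\<in>I. \<alpha> j t \<noteq> 0"
      then show ?thesis
        using j \<alpha>nn \<beta> by (auto simp: less_le)
    qed
    \<comment> \<open>For a general \<open>k\<close> the sign of \<open>\<alpha> k t\<close> is not
      known beforehand: finiteness of \<open>1 / L t\<close> excludes zero, and positivity of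
      \<open>1 / L t\<close> and \<open>\<beta> k t\<close> then excludes negative values.\<close>
    have ratio: "\<alpha> k t > 0 \<and> ?f t = \<beta> k t / \<alpha> k t"
      if k: "k \<in> {1..N}" and t: "t \<in> I" and L: "L t > 0"
        and eq: "1 / L t = ereal (\<beta> k t) / ereal (\<alpha> k t)" for k t
    proof -
      obtain l where l: "L t = ereal l" "l > 0"
        using j(2) t L by auto
      then have inv: "ereal (\<beta> k t) / ereal (\<alpha> k t) = ereal (1 / l)"
        using eq by (simp add: divide_ereal_def divide_inverse one_ereal_def)
      have nz: "\<alpha> k t \<noteq> 0"
        using inv \<beta>[OF k t] by (auto simp: divide_ereal_def)
      then have "\<beta> k t / \<alpha> k t = 1 / l"
        using inv by simp
      then have "\<beta> k t / \<alpha> k t > 0"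
        using l(2) by simp
      then show ?thesis
        using \<beta>[OF k t] nz eq by (simp add: zero_less_divide_iff)
    qed
    have zero: "real_of_ereal (1 / 0) = 0"
      by (simp add: divide_ereal_def)
    obtain a b c d where fl: "\<And>t. t \<in> I \<Longrightarrow> c * t + d > 0"
      "\<And>t. t \<in> I \<Longrightarrow> ?f t = (a * t + b) / (c * t + d)"
      using sgnL
    proof
      \<comment> \<open>Here \<open>?f\<close> is 0, written as
        \<open>(0 * t + 0) / (0 * t + 1)\<close> to keep the denominator positive.\<close>
      assume "\<forall>t\<in>I. L t = 0"
      then show ?thesis
        using zero by (intro that[of 0 1 0 0]) auto
    next
      assume L: "\<forall>t\<in>I. L t > 0"
      obtain c d where cd: "\<And>t. t \<in> I \<Longrightarrow> \<alpha> j t = c * t + d"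
        using aff(1)[OF j(1)] I01 unfolding affine_fun_on_def by blast
      obtain a b where ab: "\<And>t. t \<in> I \<Longrightarrow> \<beta> j t = a * t + b"
        using aff(2)[OF j(1)] I01 unfolding affine_fun_on_def by blast
      show ?thesis
      proof (rule that[of c d a b])
        fix t assume t: "t \<in> I"
        then have "\<alpha> j t > 0 \<and> ?f t = \<beta> j t / \<alpha> j t"
          using ratio[OF j(1) t _ eqj] L by blast
        then show "c * t + d > 0" "?f t = (a * t + b) / (c * t + d)"
          using cd[OF t] ab[OF t] by simp_all
      qed
    qed
    show "fractional_linear_on I ?f"
      unfolding fractional_linear_on_def using fl by (metis less_irrefl)
    show "smooth_fun_on I ?f"
      using smooth_fun_on_fractional_linear[of I c d ?f a b] lim fl by (metis less_irrefl)
    show "(\<lambda>t. sgn (higher_deriv_within I 2 ?f t)) constant_on I"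
      using sgn_second_deriv_fractional_linear_constant[of I c d ?f a b] lim fl by blast
    fix k assume k: "k \<in> {1..N}"
    show "(\<forall>t\<in>I. 1 / L t = ereal (\<beta> k t) / ereal (\<alpha> k t)) \<longrightarrow>
          (affine_fun_on I ?f \<longleftrightarrow> \<alpha> k constant_on I \<or> proportional_on I (\<alpha> k) (\<beta> k))"
    proof
      assume eqk: "\<forall>t\<in>I. 1 / L t = ereal (\<beta> k t) / ereal (\<alpha> k t)"
      from sgnL show "affine_fun_on I ?f \<longleftrightarrow> \<alpha> k constant_on I \<or> proportional_on I (\<alpha> k) (\<beta> k)"
      proof
        \<comment> \<open>Both sides of the equivalence hold: \<open>?f\<close> vanishes on
          \<open>I\<close>, and so does \<open>\<alpha> k\<close>, since a nonzero value would make
          the quotient finite.\<close>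
        assume L: "\<forall>t\<in>I. L t = 0"
        then have "affine_fun_on I ?f"
          unfolding affine_fun_on_def using zero by (intro exI[of _ 0]) simp
        moreover have "\<alpha> k t = 0" if "t \<in> I" for t
        proof (rule ccontr)
          assume "\<alpha> k t \<noteq> 0"
          moreover have "1 / L t = \<infinity>"
            using L that by (simp add: divide_ereal_def)
          ultimately show False
            using eqk that by auto
        qed
        then have "\<alpha> k constant_on I"
          unfolding constant_on_def by blast
        ultimately show ?thesis
          by blast
      next
        assume L: "\<forall>t\<in>I. L t > 0"
        have "\<alpha> k t > 0" "?f t = \<beta> k t / \<alpha> k t" if "t \<in> I" for t
          using ratio[OF k that] L eqk that by auto
        moreover have "affine_fun_on I (\<alpha> k)" "affine_fun_on I (\<beta> k)"
          using aff[OF k] I01 unfolding affine_fun_on_def by blast+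
        ultimately show ?thesis
          using affine_ratio_affine_iff[OF inf, of "\<alpha> k" "\<beta> k" ?f] by (metis less_irrefl)
      qed
    qed
  qed
qed

end
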